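(* Let $G$ be a finite group. Then the enhanced power graph $\mathcal{P}_E(G)$ is minimally connected if and only if one of the following holds: (i) $G$ is cyclic; (ii) $G\cong \mathbb{Z}_2\times\mathbb{Z}_2\times\cdots\times\mathbb{Z}_2$ (a direct product of finitely many copies of the cyclic group $\mathbb{Z}_2$ of order $2$).
   Context: The enhanced power graph $\mathcal{P}_E(G)$ of a group $G$ is the simple undirected graph with vertex set $G$ in which two distinct vertices $x,y$ are adjacent if $x,y\in\langle z\rangle$ for some $z\in G$. The vertex connectivity $\kappa(\Gamma)$ of a graph $\Gamma$ is the minimum size of a set $S$ of vertices such that $\Gamma - S$ is disconnected or has only one vertex (so $\kappa(\Gamma)=0$ if $\Gamma$ is already disconnected or has one vertex). $\Gamma$ is minimally connected if $\kappa(\Gamma-\epsilon)=\kappa(\Gamma)-1$ for every edge $\epsilon$ of $\Gamma$, where $\Gamma-\epsilon$ is $\Gamma$ with the edge $\epsilon$ removed (all vertices kept). *)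

theory Defs
  imports
    "HOL-Algebra.Elementary_Groups"
    "HOL-Algebra.Product_Groups"
    "Graph_Theory.Digraph_Component"
begin

text \<open>
  As in the Graph-Theory entry, a simple undirected graph is a \<^locale>\<open>pair_graph\<close>: a finite,
  loop-free, symmetric digraph. An edge between \<open>u\<close> and \<open>v\<close> is the pair of
  arcs \<open>(u, v)\<close>, \<open>(v, u)\<close>.
\<close>

definition enhanced_power_graph :: "('a, 'b) monoid_scheme \<Rightarrow> 'a pair_pre_digraph" where
  "enhanced_power_graph G =
     \<lparr> pverts = carrier G,
       parcs = {(x, y). x \<in> carrier G \<and> y \<in> carrier G \<and> x \<noteq> y \<and>
                  (\<exists>z \<in> carrier G. x \<in> generate G {z} \<and> y \<in> generate G {z})} \<rparr>"

lemma (in group) pair_graph_enhanced_power_graph: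
  assumes "finite (carrier G)"
  shows "pair_graph (enhanced_power_graph G)"
proof
  have "parcs (enhanced_power_graph G) \<subseteq> carrier G \<times> carrier G"
    by (auto simp: enhanced_power_graph_def)
  then show "finite (parcs (enhanced_power_graph G))"
    using assms finite_subset by blast
  show "symmetric (with_proj (enhanced_power_graph G))"
    by (auto simp: symmetric_def sym_def enhanced_power_graph_def)
qed (use assms in \<open>auto simp: enhanced_power_graph_def\<close>)

definition del_edge :: "'a pair_pre_digraph \<Rightarrow> 'a \<Rightarrow> 'a \<Rightarrow> 'a pair_pre_digraph" where
  "del_edge \<Gamma> u v = \<lparr> pverts = pverts \<Gamma>, parcs = parcs \<Gamma> - {(u, v), (v, u)} \<rparr>"

text \<open>
  Meant for finite \<open>\<Gamma>\<close>. The constant \<^const>\<open>connected\<close> is false for the null graph, so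
  \<open>S = pverts \<Gamma>\<close> is admitted; if \<open>\<Gamma>\<close> has a vertex this does not
  affect the minimum, since removing all vertices but one is cheaper and also admitted.
\<close>

definition vertex_connectivity :: "'a pair_pre_digraph \<Rightarrow> nat" where
  "vertex_connectivity \<Gamma> =
     (LEAST k. \<exists>S. S \<subseteq> pverts \<Gamma> \<and> finite S \<and> card S = k \<and>
        (\<not> connected (with_proj \<Gamma> \<restriction> (pverts \<Gamma> - S)) \<or> card (pverts \<Gamma> - S) = 1))"

text \<open>The integers avoid truncated subtraction when the vertex connectivity is 0.\<close>

definition minimally_connected :: "'a pair_pre_digraph \<Rightarrow> bool" where
  "minimally_connected \<Gamma> \<longleftrightarrow>
     (\<forall>(u, v) \<in> parcs \<Gamma>.
        int (vertex_connectivity (del_edge \<Gamma> u v)) = int (vertex_connectivity \<Gamma>) - 1)"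

end

theory Submission
  imports Defs
begin

text \<open>
  In a noncyclic group two elements are non-adjacent, so \<open>\<kappa>\<close> is at most \<open>\<bar>G\<bar> - 2\<close>. An element \<open>x\<close> with
  \<open>x \<noteq> x\<inverse>\<close> is adjacent to \<open>x\<inverse>\<close> and has the same other neighbours as \<open>x\<inverse>\<close>; deleting the edge between
  such twins keeps every connected induced subgraph on at least three vertices connected, hence does
  not lower \<open>\<kappa>\<close>. So minimal connectedness forces every element to be an involution or \<open>1\<close>.
  Conversely the graph is complete for cyclic groups and a star for elementary abelian 2-groups.
\<close>

section \<open>Vertex cuts\<close>

text \<open>The condition under the \<open>LEAST\<close> of \<open>vertex_connectivity\<close>,
  named so that minimal witnesses can be obtained and transferred between graphs.\<close>

definition vertex_cut :: "'a pair_pre_digraph \<Rightarrow> 'a set \<Rightarrow> bool" where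
  "vertex_cut \<Gamma> S \<longleftrightarrow> S \<subseteq> pverts \<Gamma> \<and> finite S \<and>
     (\<not> connected (with_proj \<Gamma> \<restriction> (pverts \<Gamma> - S)) \<or> card (pverts \<Gamma> - S) = 1)"

text \<open>Symmetrising changes nothing for symmetric arcs, and \<open>rtrancl_on W\<close> visits
  only vertices of \<open>W\<close>, so the arcs of the whole graph give the same walks as those of
  the induced subgraph.\<close>

lemma connected_induced_iff:
  assumes "sym (parcs \<Gamma>)"
  shows "connected (with_proj \<Gamma> \<restriction> W) \<longleftrightarrow>
    W \<noteq> {} \<and> (\<forall>u\<in>W. \<forall>v\<in>W. (u, v) \<in> rtrancl_on W (parcs \<Gamma>))"
proof -
  have "parcs (mk_symmetric (with_proj \<Gamma> \<restriction> W)) = parcs \<Gamma> \<inter> W \<times> W"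
    using assms by (auto simp: mk_symmetric_def sym_def)
  moreover have "(u, v) \<in> rtrancl_on W (parcs \<Gamma> \<inter> W \<times> W)"
    if "(u, v) \<in> rtrancl_on W (parcs \<Gamma>)" for u v
    using that by (induction rule: rtrancl_on_induct) (auto intro: rtrancl_on_into_rtrancl_on)
  then have "rtrancl_on W (parcs \<Gamma> \<inter> W \<times> W) = rtrancl_on W (parcs \<Gamma>)"
    by (auto intro: rtrancl_on_mono)
  ultimately show ?thesis
    unfolding connected_def strongly_connected_def reachable_def
    by (simp add: mk_symmetric_def)
qed

text \<open>By induction along a walk in \<open>W\<close> starting at \<open>u\<close>, the walk
  never leaves \<open>u\<close>.\<close>

lemma not_connected_isolated:
  assumes "sym (parcs \<Gamma>)" "u \<in> W" "v \<in> W" "u \<noteq> v" "\<And>w. w \<in> W \<Longrightarrow> (u, w) \<notin> parcs \<Gamma>"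
  shows "\<not> connected (with_proj \<Gamma> \<restriction> W)"
proof
  assume "connected (with_proj \<Gamma> \<restriction> W)"
  then have "(u, v) \<in> rtrancl_on W (parcs \<Gamma>)"
    using assms by (simp add: connected_induced_iff)
  then have "v = u"
    by (induction rule: rtrancl_on_induct) (use assms(5) in auto)
  with \<open>u \<noteq> v\<close> show False by simp
qed

lemma connected_complete:
  assumes "sym (parcs \<Gamma>)" "W \<noteq> {}"
    and "\<And>u v. u \<in> W \<Longrightarrow> v \<in> W \<Longrightarrow> u \<noteq> v \<Longrightarrow> (u, v) \<in> parcs \<Gamma>"
  shows "connected (with_proj \<Gamma> \<restriction> W)"
proof -
  have "(u, v) \<in> rtrancl_on W (parcs \<Gamma>)" if "u \<in> W" "v \<in> W" for u v
    using that assms(3)[of u v] by (cases "u = v") (auto intro: rtrancl_on_into_rtrancl_on)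
  with assms show ?thesis by (simp add: connected_induced_iff)
qed

lemma connected_hub:
  assumes "sym (parcs \<Gamma>)" "h \<in> W" "\<And>u. u \<in> W \<Longrightarrow> u \<noteq> h \<Longrightarrow> (h, u) \<in> parcs \<Gamma>"
  shows "connected (with_proj \<Gamma> \<restriction> W)"
proof -
  have 1: "(h, v) \<in> rtrancl_on W (parcs \<Gamma>)" if "v \<in> W" for v
    using that assms by (cases "v = h") (auto intro: rtrancl_on_into_rtrancl_on)
  have 2: "(u, h) \<in> rtrancl_on W (parcs \<Gamma>)" if "u \<in> W" for u
    using that assms by (cases "u = h") (auto intro: rtrancl_on_into_rtrancl_on dest: symD)
  have "(u, v) \<in> rtrancl_on W (parcs \<Gamma>)" if "u \<in> W" "v \<in> W" for u v
    using 1[OF that(2)] 2[OF that(1)] by (rule rtrancl_on_trans[rotated])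
  with assms show ?thesis by (auto simp: connected_induced_iff)
qed

section \<open>Bounds on the vertex connectivity\<close>

lemma vertex_connectivity_eq_Least:
  "vertex_connectivity \<Gamma> = (LEAST k. \<exists>S. vertex_cut \<Gamma> S \<and> card S = k)"
  unfolding vertex_connectivity_def vertex_cut_def by (rule arg_cong[where f = Least]) auto

lemma vertex_connectivity_le:
  "vertex_cut \<Gamma> S \<Longrightarrow> vertex_connectivity \<Gamma> \<le> card S"
  unfolding vertex_connectivity_eq_Least by (rule Least_le) auto

text \<open>The null graph counts as not connected. This guarantees that the \<open>LEAST\<close>
  ranges over a nonempty set and is attained.\<close>

lemma vertex_cut_pverts: "finite (pverts \<Gamma>) \<Longrightarrow> vertex_cut \<Gamma> (pverts \<Gamma>)"
  by (auto simp: vertex_cut_def connected_def strongly_connected_def mk_symmetric_def)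

lemma vertex_connectivity_attained:
  assumes "finite (pverts \<Gamma>)"
  obtains S where "vertex_cut \<Gamma> S" "card S = vertex_connectivity \<Gamma>"
proof -
  have "\<exists>S. vertex_cut \<Gamma> S \<and> card S = vertex_connectivity \<Gamma>"
    unfolding vertex_connectivity_eq_Least
    by (rule LeastI_ex) (use vertex_cut_pverts[OF assms] in blast)
  then show thesis using that by blast
qed

text \<open>Removing every vertex except \<open>u\<close> and \<open>v\<close> leaves two isolated
  vertices.\<close>

lemma vertex_connectivity_le_nonadjacent:
  assumes "sym (parcs \<Gamma>)" "finite (pverts \<Gamma>)" "u \<in> pverts \<Gamma>" "v \<in> pverts \<Gamma>" "u \<noteq> v"
    and "(u, v) \<notin> parcs \<Gamma>" "(u, u) \<notin> parcs \<Gamma>"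
  shows "vertex_connectivity \<Gamma> \<le> card (pverts \<Gamma>) - 2"
proof -
  have W: "pverts \<Gamma> - (pverts \<Gamma> - {u, v}) = {u, v}" using assms by auto
  have "\<not> connected (with_proj \<Gamma> \<restriction> {u, v})"
    by (rule not_connected_isolated[of _ u _ v]) (use assms in auto)
  then have "vertex_cut \<Gamma> (pverts \<Gamma> - {u, v})"
    using assms(2) by (simp add: vertex_cut_def W)
  from vertex_connectivity_le[OF this] show ?thesis
    using assms by (simp add: card_Diff_subset)
qed

text \<open>Every nonempty induced subgraph is connected, so a cut leaves at most one
  vertex.\<close>

lemma vertex_connectivity_complete:
  assumes "sym (parcs \<Gamma>)" "finite (pverts \<Gamma>)"
    and "\<And>u v. u \<in> pverts \<Gamma> \<Longrightarrow> v \<in> pverts \<Gamma> \<Longrightarrow> u \<noteq> v \<Longrightarrow> (u, v) \<in> parcs \<Gamma>"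
  shows "vertex_connectivity \<Gamma> = card (pverts \<Gamma>) - 1"
proof (rule antisym)
  show "vertex_connectivity \<Gamma> \<le> card (pverts \<Gamma>) - 1"
  \<comment> \<open>Without vertices both sides are 0, the right one by truncated
    subtraction.\<close>
  proof (cases "pverts \<Gamma> = {}")
    case True
    then show ?thesis
      using vertex_connectivity_le[OF vertex_cut_pverts[OF assms(2)]] by simp
  next
    case False
    then obtain u where u: "u \<in> pverts \<Gamma>" by auto
    then have "pverts \<Gamma> - (pverts \<Gamma> - {u}) = {u}" by auto
    then have "vertex_cut \<Gamma> (pverts \<Gamma> - {u})"
      using assms(2) by (simp add: vertex_cut_def)
    from vertex_connectivity_le[OF this] show ?thesis
      using assms(2) u by simp
  qed
  obtain S where S: "vertex_cut \<Gamma> S" "card S = vertex_connectivity \<Gamma>"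
    using vertex_connectivity_attained[OF assms(2)] .
  have "card (pverts \<Gamma> - S) \<le> 1"
  proof (cases "pverts \<Gamma> - S = {}")
    case False
    then have "connected (with_proj \<Gamma> \<restriction> (pverts \<Gamma> - S))"
      by (intro connected_complete) (use assms in auto)
    with S(1) show ?thesis by (simp add: vertex_cut_def)
  next
    case True
    then show ?thesis by (metis card.empty zero_le)
  qed
  then show "card (pverts \<Gamma>) - 1 \<le> vertex_connectivity \<Gamma>"
    using S assms(2) by (simp add: vertex_cut_def card_Diff_subset)
qed

section \<open>Edge deletion: twins, complete graphs and stars\<close>

lemma pverts_del_edge [simp]: "pverts (del_edge \<Gamma> u v) = pverts \<Gamma>"
  and parcs_del_edge [simp]: "parcs (del_edge \<Gamma> u v) = parcs \<Gamma> - {(u, v), (v, u)}"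
  by (simp_all add: del_edge_def)

lemma sym_del_edge: "sym (parcs \<Gamma>) \<Longrightarrow> sym (parcs (del_edge \<Gamma> u v))"
  by (auto simp: sym_def)

text \<open>The only arcs lost join \<open>x\<close> and \<open>y\<close>, and a common neighbour of
  the twins inside \<open>W\<close> provides a detour. A third vertex in \<open>W\<close> forces
  such a neighbour to exist, since some walk must leave \<open>{x, y}\<close>.\<close>

lemma connected_del_edge_twins:
  assumes sym: "sym (parcs \<Gamma>)" and ne: "x \<noteq> y"
    and twins: "\<And>w. w \<noteq> x \<Longrightarrow> w \<noteq> y \<Longrightarrow> (x, w) \<in> parcs \<Gamma> \<longleftrightarrow> (y, w) \<in> parcs \<Gamma>"
    and con: "connected (with_proj \<Gamma> \<restriction> W)" and card: "card W \<ge> 3"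
  shows "connected (with_proj (del_edge \<Gamma> x y) \<restriction> W)"
proof -
  let ?R = "rtrancl_on W (parcs (del_edge \<Gamma> x y))"
  have common: "\<exists>w\<in>W. w \<noteq> x \<and> w \<noteq> y \<and> (x, w) \<in> parcs \<Gamma> \<and> (y, w) \<in> parcs \<Gamma>"
    if "x \<in> W" "y \<in> W"
  proof (rule ccontr)
    assume no: "\<not> ?thesis"
    have "card {x, y} < card W" using card card_insert_le_m1[of 2 "{y}" x] by simp
    then have "\<not> W \<subseteq> {x, y}" by (metis card_mono finite.emptyI finite.insertI not_le)
    then obtain v where v: "v \<in> W" "v \<notin> {x, y}" by blast
    have "(x, v) \<in> rtrancl_on W (parcs \<Gamma>)"
      using con that v by (simp add: connected_induced_iff[OF sym])
    \<comment> \<open>A neighbour in \<open>W\<close> of one twin, outside \<open>{x, y}\<close>,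
      would be a neighbour of both. In the absence of such a vertex every walk from \<open>x\<close>
      is trapped in \<open>{x, y}\<close>.\<close>
    then have "v \<in> {x, y}"
      by (induction rule: rtrancl_on_induct) (use no twins that in auto)
    with v show False by simp
  qed
  have step: "(a, b) \<in> ?R" if ab: "(a, b) \<in> parcs \<Gamma>" "a \<in> W" "b \<in> W" for a b
  proof (cases "{a, b} = {x, y}")
    case True
    with ab have "x \<in> W" "y \<in> W" by (auto simp: doubleton_eq_iff)
    from common[OF this] obtain w where w: "w \<in> W" "w \<noteq> x" "w \<noteq> y"
      "(x, w) \<in> parcs \<Gamma>" "(y, w) \<in> parcs \<Gamma>" by blast
    then have "(w, x) \<in> parcs \<Gamma>" "(w, y) \<in> parcs \<Gamma>" using sym by (auto dest: symD)
    with w True have "(a, w) \<in> parcs (del_edge \<Gamma> x y)" "(w, b) \<in> parcs (del_edge \<Gamma> x y)"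
      by (auto simp: doubleton_eq_iff)
    with w ab show ?thesis by (blast intro: rtrancl_on_into_rtrancl_on rtrancl_on_refl)
  next
    case False
    with ab show ?thesis
      by (intro rtrancl_on_into_rtrancl_on[OF rtrancl_on_refl]) auto
  qed
  have "(a, b) \<in> ?R" if "(a, b) \<in> rtrancl_on W (parcs \<Gamma>)" for a b
    using that by (induction rule: rtrancl_on_induct) (blast intro: step rtrancl_on_trans)+
  with con show ?thesis
    by (simp add: connected_induced_iff[OF sym] connected_induced_iff[OF sym_del_edge[OF sym]]
        del: parcs_del_edge)
qed

text \<open>A smaller cut would leave at least three vertices, which the deletion cannot disconnect,
  so it would already cut \<open>\<Gamma>\<close>. The \<open>min\<close> accounts for complete
  graphs, where deleting an edge does lower the connectivity from \<open>n - 1\<close> to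
  \<open>n - 2\<close>.\<close>

lemma vertex_connectivity_del_edge_twins:
  assumes "sym (parcs \<Gamma>)" "finite (pverts \<Gamma>)" "x \<noteq> y"
    and "\<And>w. w \<noteq> x \<Longrightarrow> w \<noteq> y \<Longrightarrow> (x, w) \<in> parcs \<Gamma> \<longleftrightarrow> (y, w) \<in> parcs \<Gamma>"
  shows "min (vertex_connectivity \<Gamma>) (card (pverts \<Gamma>) - 2)
    \<le> vertex_connectivity (del_edge \<Gamma> x y)"
proof (rule ccontr)
  assume less: "\<not> ?thesis"
  obtain S where S: "vertex_cut (del_edge \<Gamma> x y) S"
    "card S = vertex_connectivity (del_edge \<Gamma> x y)"
    using vertex_connectivity_attained[of "del_edge \<Gamma> x y"] assms(2) by auto
  then have sub: "S \<subseteq> pverts \<Gamma>" "finite S" by (auto simp: vertex_cut_def)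
  then have card: "card (pverts \<Gamma> - S) \<ge> 3"
    using less S(2) by (simp add: card_Diff_subset)
  have "\<not> vertex_cut \<Gamma> S"
    using less S(2) vertex_connectivity_le[of \<Gamma> S] by auto
  with sub have "connected (with_proj \<Gamma> \<restriction> (pverts \<Gamma> - S))"
    by (simp add: vertex_cut_def)
  then have "connected (with_proj (del_edge \<Gamma> x y) \<restriction> (pverts \<Gamma> - S))"
    using connected_del_edge_twins[OF assms(1,3,4) _ card] by blast
  with S(1) card show False by (simp add: vertex_cut_def)
qed

lemma minimally_connected_complete:
  assumes "sym (parcs \<Gamma>)" "finite (pverts \<Gamma>)" "parcs \<Gamma> \<subseteq> pverts \<Gamma> \<times> pverts \<Gamma>" "irrefl (parcs \<Gamma>)"
    and complete: "\<And>u v. u \<in> pverts \<Gamma> \<Longrightarrow> v \<in> pverts \<Gamma> \<Longrightarrow> u \<noteq> v \<Longrightarrow> (u, v) \<in> parcs \<Gamma>"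
  shows "minimally_connected \<Gamma>"
  unfolding minimally_connected_def
proof clarify
  fix x y assume "(x, y) \<in> parcs \<Gamma>"
  then have xy: "x \<in> pverts \<Gamma>" "y \<in> pverts \<Gamma>" "x \<noteq> y"
    using assms by (auto simp: irrefl_def)
  have "card {x, y} \<le> card (pverts \<Gamma>)"
    by (rule card_mono) (use assms(2) xy in auto)
  \<comment> \<open>This keeps the truncated differences \<open>n - 1\<close> and
    \<open>n - 2\<close> exactly one apart.\<close>
  then have two: "2 \<le> card (pverts \<Gamma>)" using xy by simp
  have \<kappa>: "vertex_connectivity \<Gamma> = card (pverts \<Gamma>) - 1"
    by (rule vertex_connectivity_complete[OF assms(1,2) complete])
  have "vertex_connectivity (del_edge \<Gamma> x y) \<le> card (pverts \<Gamma>) - 2"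
    using vertex_connectivity_le_nonadjacent[OF sym_del_edge[OF assms(1)], of x y x y] assms xy
    by (auto simp: irrefl_def)
  \<comment> \<open>In a complete graph any two distinct vertices are twins, so the
    \<open>min\<close> bound gives the matching lower bound.\<close>
  moreover have "min (vertex_connectivity \<Gamma>) (card (pverts \<Gamma>) - 2)
      \<le> vertex_connectivity (del_edge \<Gamma> x y)"
    by (rule vertex_connectivity_del_edge_twins[OF assms(1,2) xy(3)])
      (use assms xy in blast)
  ultimately show
    "int (vertex_connectivity (del_edge \<Gamma> x y)) = int (vertex_connectivity \<Gamma>) - 1"
    using \<kappa> two by simp
qed

text \<open>Removing the hub \<open>h\<close> is a cut of size one, and deleting a spoke isolates
  its leaf, so that the empty set becomes a cut. With no leaf there is no edge to check.\<close>

lemma minimally_connected_star: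
  assumes "finite V" "h \<in> V" "pverts \<Gamma> = V"
    and E: "parcs \<Gamma> = {h} \<times> (V - {h}) \<union> (V - {h}) \<times> {h}"
  shows "minimally_connected \<Gamma>"
proof -
  have sym: "sym (parcs \<Gamma>)" unfolding E by (auto simp: sym_def)
  have *: "vertex_connectivity \<Gamma> = 1 \<and> vertex_connectivity (del_edge \<Gamma> x h) = 0"
    if x: "x \<in> V - {h}" for x
  proof -
    have "vertex_cut (del_edge \<Gamma> x h) {}"
      using not_connected_isolated[OF sym_del_edge[OF sym], of x V h x h] x assms(2,3)
      by (auto simp: vertex_cut_def E)
    from vertex_connectivity_le[OF this] have 0: "vertex_connectivity (del_edge \<Gamma> x h) = 0"
      by simp
    have "vertex_cut \<Gamma> {h}"
    \<comment> \<open>A single leaf makes \<open>{h}\<close> a cut by the one-vertex clause; several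
      leaves make it one by disconnection.\<close>
    proof (cases "V - {h} = {x}")
      case True
      then show ?thesis using assms by (simp add: vertex_cut_def)
    next
      case False
      then obtain v where "v \<in> V - {h}" "v \<noteq> x" using x by auto
      then have "\<not> connected (with_proj \<Gamma> \<restriction> (V - {h}))"
        using x by (intro not_connected_isolated[OF sym, of x _ v]) (auto simp: E)
      then show ?thesis using assms by (simp add: vertex_cut_def)
    qed
    from vertex_connectivity_le[OF this] have le: "vertex_connectivity \<Gamma> \<le> 1" by simp
    have "vertex_connectivity \<Gamma> \<noteq> 0"
    proof
      assume "vertex_connectivity \<Gamma> = 0"
      then obtain S where S: "vertex_cut \<Gamma> S" "card S = 0"
        using vertex_connectivity_attained[of \<Gamma>] assms by metis
      then have "S = {}" by (auto simp: vertex_cut_def)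
      moreover have "connected (with_proj \<Gamma> \<restriction> V)"
        by (rule connected_hub[OF sym assms(2)]) (auto simp: E)
      ultimately have "card V = 1" using S assms(3) by (simp add: vertex_cut_def)
      then show False using x assms(2) by (auto simp: card_1_singleton_iff)
    qed
    with le 0 show ?thesis by simp
  qed
  have swap: "del_edge \<Gamma> x y = del_edge \<Gamma> y x" for x y
    by (simp add: del_edge_def insert_commute)
  show ?thesis unfolding minimally_connected_def
  proof clarify
    fix x y assume xy: "(x, y) \<in> parcs \<Gamma>"
    then consider "x \<in> V - {h}" "y = h" | "y \<in> V - {h}" "x = h" by (auto simp: E)
    then show "int (vertex_connectivity (del_edge \<Gamma> x y)) = int (vertex_connectivity \<Gamma>) - 1"
    proof cases
      case 1
      then show ?thesis using *[of x] by simp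
    next
      case 2
      then show ?thesis using *[of y] by (simp add: swap[of h y])
    qed
  qed
qed

section \<open>The enhanced power graph\<close>

lemma pverts_enhanced_power_graph [simp]: "pverts (enhanced_power_graph G) = carrier G"
  by (simp add: enhanced_power_graph_def)

lemma parcs_enhanced_power_graph:
  "(x, y) \<in> parcs (enhanced_power_graph G) \<longleftrightarrow> x \<in> carrier G \<and> y \<in> carrier G \<and> x \<noteq> y \<and>
     (\<exists>z\<in>carrier G. x \<in> generate G {z} \<and> y \<in> generate G {z})"
  by (simp add: enhanced_power_graph_def)

lemma sym_parcs_enhanced_power_graph: "sym (parcs (enhanced_power_graph G))"
  by (auto simp: sym_def parcs_enhanced_power_graph)

context group
begin

section \<open>Cyclic groups and complete graphs\<close>

lemma cyclic_group_iff_generate: "cyclic_group G \<longleftrightarrow> (\<exists>z\<in>carrier G. carrier G = generate G {z})"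
  unfolding cyclic_group by (rule bex_cong[OF refl]) (simp add: generate_pow full_SetCompr_eq)

text \<open>For the converse, take \<open>z\<close> of maximal order. Any other \<open>y\<close>
  lies with \<open>z\<close> in some \<open>generate G {w}\<close>, which contains
  \<open>generate G {z}\<close> and equals it by maximality, so \<open>z\<close> generates the
  group.\<close>

lemma cyclic_iff_enhanced_power_graph_complete:
  assumes fin: "finite (carrier G)"
  shows "cyclic_group G \<longleftrightarrow>
    (\<forall>x\<in>carrier G. \<forall>y\<in>carrier G. x \<noteq> y \<longrightarrow> (x, y) \<in> parcs (enhanced_power_graph G))"
proof
  assume "cyclic_group G"
  then show "\<forall>x\<in>carrier G. \<forall>y\<in>carrier G. x \<noteq> y \<longrightarrow> (x, y) \<in> parcs (enhanced_power_graph G)"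
    unfolding cyclic_group_iff_generate parcs_enhanced_power_graph by blast
next
  assume complete:
    "\<forall>x\<in>carrier G. \<forall>y\<in>carrier G. x \<noteq> y \<longrightarrow> (x, y) \<in> parcs (enhanced_power_graph G)"
  define c where "c z = card (generate G {z})" for z
  have "\<exists>z\<in>carrier G. \<forall>w\<in>carrier G. c w \<le> c z"
  proof -
    have "Max (c ` carrier G) \<in> c ` carrier G" using fin by (intro Max_in) auto
    then obtain z where "z \<in> carrier G" "c z = Max (c ` carrier G)" by auto
    with fin show ?thesis by (metis Max_ge finite_imageI imageI)
  qed
  then obtain z where z: "z \<in> carrier G" "\<And>w. w \<in> carrier G \<Longrightarrow> c w \<le> c z" by auto
  have "y \<in> generate G {z}" if y: "y \<in> carrier G" for y
  proof (cases "y = z")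
    case True
    then show ?thesis by (simp add: generate.incl)
  next
    case False
    then obtain w where w: "w \<in> carrier G" "z \<in> generate G {w}" "y \<in> generate G {w}"
      using complete y z(1) unfolding parcs_enhanced_power_graph by blast
    have "generate G {z} \<subseteq> generate G {w}"
      using w by (intro generate_subgroup_incl generate_is_subgroup) auto
    moreover have "finite (generate G {w})"
      using generate_incl[of "{w}"] w fin finite_subset by blast
    ultimately have "generate G {z} = generate G {w}"
      using z(2)[OF w(1)] by (intro card_seteq) (auto simp: c_def)
    with w show ?thesis by simp
  qed
  moreover have "generate G {z} \<subseteq> carrier G" using z by (intro generate_incl) auto
  ultimately show "cyclic_group G" unfolding cyclic_group_iff_generate using z(1) by blast
qed

section \<open>Inverse pairs as twins, and involutions\<close>

lemma inv_mem_generate_iff: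
  assumes "x \<in> carrier G" "z \<in> carrier G"
  shows "inv x \<in> generate G {z} \<longleftrightarrow> x \<in> generate G {z}"
  using generate_m_inv_closed[of "{z}" x] generate_m_inv_closed[of "{z}" "inv x"] assms by auto

text \<open>A noncyclic group has a nonadjacent pair, so the \<open>min\<close> in the twin bound is
  the connectivity itself. Deleting the edge between \<open>x\<close> and \<open>inv x\<close> then
  cannot lower it.\<close>

lemma minimally_connected_imp_involutions:
  assumes fin: "finite (carrier G)" and nc: "\<not> cyclic_group G"
    and mc: "minimally_connected (enhanced_power_graph G)" and x: "x \<in> carrier G"
  shows "x \<otimes> x = \<one>"
proof (rule ccontr)
  let ?\<Gamma> = "enhanced_power_graph G"
  assume "x \<otimes> x \<noteq> \<one>"
  then have ne: "x \<noteq> inv x" using x r_inv by metis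
  obtain u v where uv: "u \<in> carrier G" "v \<in> carrier G" "u \<noteq> v" "(u, v) \<notin> parcs ?\<Gamma>"
    using nc cyclic_iff_enhanced_power_graph_complete[OF fin] by blast
  then have le: "vertex_connectivity ?\<Gamma> \<le> card (carrier G) - 2"
    using vertex_connectivity_le_nonadjacent[OF sym_parcs_enhanced_power_graph, of G u v] fin
    by (simp add: parcs_enhanced_power_graph)
  have "(x, w) \<in> parcs ?\<Gamma> \<longleftrightarrow> (inv x, w) \<in> parcs ?\<Gamma>" if "w \<noteq> x" "w \<noteq> inv x" for w
    using that x inv_mem_generate_iff[OF x] by (auto simp: parcs_enhanced_power_graph)
  from vertex_connectivity_del_edge_twins[OF sym_parcs_enhanced_power_graph _ ne this] le fin
  have "vertex_connectivity ?\<Gamma> \<le> vertex_connectivity (del_edge ?\<Gamma> x (inv x))"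
    by simp
  moreover have "(x, inv x) \<in> parcs ?\<Gamma>"
    using x ne inv_mem_generate_iff[OF x x] generate.incl[of x "{x}" G]
    by (auto simp: parcs_enhanced_power_graph)
  ultimately show False using mc by (auto simp: minimally_connected_def)
qed

lemma generate_involution:
  assumes "z \<in> carrier G" "z \<otimes> z = \<one>"
  shows "generate G {z} = {\<one>, z}"
proof
  have "inv z = z" using assms inv_equality by blast
  then have "subgroup {\<one>, z} G" using assms by (intro subgroupI) auto
  then show "generate G {z} \<subseteq> {\<one>, z}" by (intro generate_subgroup_incl) auto
  show "{\<one>, z} \<subseteq> generate G {z}" by (auto intro: generate.one generate.incl)
qed

text \<open>Each cyclic subgroup is \<open>{\<one>, z}\<close>, so of two adjacent elements one is
  \<open>\<one>\<close>: the graph is a star with hub \<open>\<one>\<close>.\<close>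

lemma involutions_imp_minimally_connected:
  assumes fin: "finite (carrier G)" and inv2: "\<And>x. x \<in> carrier G \<Longrightarrow> x \<otimes> x = \<one>"
  shows "minimally_connected (enhanced_power_graph G)"
proof (rule minimally_connected_star[OF fin one_closed])
  show "parcs (enhanced_power_graph G) = {\<one>} \<times> (carrier G - {\<one>}) \<union> (carrier G - {\<one>}) \<times> {\<one>}"
    (is "?E = ?F")
  proof (rule Set.set_eqI, unfold split_paired_all)
    fix x y
    show "(x, y) \<in> ?E \<longleftrightarrow> (x, y) \<in> ?F"
      using generate_involution[OF _ inv2] by (auto simp: parcs_enhanced_power_graph)
  qed
qed simp

section \<open>Elementary abelian 2-groups\<close>

text \<open>Each element is its own inverse, while inversion reverses products.\<close>

lemma comm_group_involutions:
  assumes inv2: "\<And>x. x \<in> carrier G \<Longrightarrow> x \<otimes> x = \<one>"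
  shows "comm_group G"
proof (rule group_comm_groupI)
  fix x y assume xy: "x \<in> carrier G" "y \<in> carrier G"
  have "inv z = z" if "z \<in> carrier G" for z using that inv2 inv_equality by blast
  then show "x \<otimes> y = y \<otimes> x" using xy inv_mult_group[of x y] by simp
qed

text \<open>The element \<open>a\<close> acts as a further basis vector: coordinate \<open>n\<close>
  decides whether it is multiplied in. Injectivity survives because \<open>a\<close> is outside the
  old image.\<close>

lemma mon_product_Z2_extend:
  assumes inv2: "\<And>x. x \<in> carrier G \<Longrightarrow> x \<otimes> x = \<one>"
    and \<phi>: "\<phi> \<in> mon (product_group {..<n} (\<lambda>_. integer_mod_group 2)) G"
    and a: "a \<in> carrier G" "a \<notin> \<phi> ` carrier (product_group {..<n} (\<lambda>_. integer_mod_group 2))"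
  shows "(\<lambda>f. \<phi> (restrict f {..<n}) \<otimes> (if f n = 0 then \<one> else a))
    \<in> mon (product_group {..<Suc n} (\<lambda>_. integer_mod_group 2)) G"
    (is "?\<psi> \<in> _")
proof -
  interpret comm_group G by (rule comm_group_involutions[OF inv2])
  let ?P = "\<lambda>n::nat. product_group {..<n} (\<lambda>_. integer_mod_group 2)"
  have grp: "group (?P m)" for m by simp
  have Z2: "k = 0 \<or> k = 1" if "k \<in> carrier (integer_mod_group 2)" for k
    using that by (auto simp: carrier_integer_mod_group)
  have restr: "restrict f {..<n} \<in> carrier (?P n)" if "f \<in> carrier (?P (Suc n))" for f
    using that by (auto simp: PiE_iff)
  have hom: "\<phi> \<in> hom (?P n) G" and inj: "\<And>f. f \<in> carrier (?P n) \<Longrightarrow> \<phi> f = \<one> \<Longrightarrow> f = \<one>\<^bsub>?P n\<^esub>"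
    using \<phi> unfolding mon_iff_hom_one[OF grp group_axioms] by blast+
  have cl: "\<phi> (restrict f {..<n}) \<in> carrier G" if "f \<in> carrier (?P (Suc n))" for f
    using hom_in_carrier[OF hom restr[OF that]] .
  have "?\<psi> \<in> hom (?P (Suc n)) G"
  proof (rule homI)
    fix f g assume fg: "f \<in> carrier (?P (Suc n))" "g \<in> carrier (?P (Suc n))"
    have fn: "f n = 0 \<or> f n = 1" and gn: "g n = 0 \<or> g n = 1"
      using fg Z2 by (auto simp: PiE_iff)
    have "restrict (f \<otimes>\<^bsub>?P (Suc n)\<^esub> g) {..<n} = restrict f {..<n} \<otimes>\<^bsub>?P n\<^esub> restrict g {..<n}"
      by auto
    then have "\<phi> (restrict (f \<otimes>\<^bsub>?P (Suc n)\<^esub> g) {..<n})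
        = \<phi> (restrict f {..<n}) \<otimes> \<phi> (restrict g {..<n})"
      using hom_mult[OF hom restr[OF fg(1)] restr[OF fg(2)]] by simp
    \<comment> \<open>When both coordinates are 1, their sum is 0 modulo 2, matched by
      \<open>a \<otimes> a = \<one>\<close>.\<close>
    moreover have "(if (f \<otimes>\<^bsub>?P (Suc n)\<^esub> g) n = 0 then \<one> else a)
        = (if f n = 0 then \<one> else a) \<otimes> (if g n = 0 then \<one> else a)"
      using fn gn a inv2 by auto
    ultimately show "?\<psi> (f \<otimes>\<^bsub>?P (Suc n)\<^esub> g) = ?\<psi> f \<otimes> ?\<psi> g"
      using a cl[OF fg(1)] cl[OF fg(2)] by (simp add: m_ac del: mult_product_group)
  qed (use cl a in auto)
  moreover have "f = \<one>\<^bsub>?P (Suc n)\<^esub>" if f: "f \<in> carrier (?P (Suc n))" and 1: "?\<psi> f = \<one>" for f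
  proof (cases "f n = 0")
    case True
    then have "restrict f {..<n} = \<one>\<^bsub>?P n\<^esub>"
      using 1 cl[OF f] inj[OF restr[OF f]] by simp
    then have "f i = 0" if "i < n" for i
      using that by (simp add: restrict_def) metis
    with True have "\<forall>i<Suc n. f i = 0" by (auto simp: less_Suc_eq)
    with f show ?thesis by (intro PiE_ext[of f "{..<Suc n}"]) auto
  next
    case False
    then have "\<phi> (restrict f {..<n}) \<otimes> a = \<one>" using 1 by simp
    then have "\<phi> (restrict f {..<n}) = inv a" using cl[OF f] a inv_equality by simp
    \<comment> \<open>A kernel element with last coordinate 1 would put \<open>a\<close> itself into
      the image of \<open>\<phi>\<close>.\<close>
    moreover have "inv a = a" using a inv2 inv_equality by blast
    ultimately show ?thesis using a(2) restr[OF f] by (metis image_eqI)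
  qed
  ultimately show ?thesis unfolding mon_iff_hom_one[OF grp group_axioms] by blast
qed

text \<open>Choose an embedding of a power of the group of order 2 with the greatest exponent. It is
  onto, since an element outside its image would allow an extension by one more factor.\<close>

lemma involutions_imp_iso_product_Z2:
  assumes fin: "finite (carrier G)" and inv2: "\<And>x. x \<in> carrier G \<Longrightarrow> x \<otimes> x = \<one>"
  shows "\<exists>n::nat. G \<cong> product_group {..<n} (\<lambda>_. integer_mod_group 2)"
proof -
  let ?P = "\<lambda>n::nat. product_group {..<n} (\<lambda>_. integer_mod_group 2)"
  have grp: "group (?P m)" for m by simp
  \<comment> \<open>Injectivity gives \<open>2 ^ n \<le> card (carrier G)\<close>; the cruder bound
    on \<open>n\<close> suffices for a greatest exponent to exist.\<close>
  have bound: "n \<le> card (carrier G)" if "\<phi> \<in> mon (?P n) G" for \<phi> n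
  proof -
    have "card (carrier (?P n)) = 2 ^ n"
      by (simp add: card_PiE carrier_integer_mod_group)
    moreover have "card (carrier (?P n)) \<le> card (carrier G)"
      using that fin by (intro card_inj_on_le[of \<phi>]) (auto simp: mon_def hom_def)
    moreover have "n < 2 ^ n" by (rule less_exp)
    ultimately show ?thesis by linarith
  qed
  have "(\<lambda>_. \<one>) \<in> mon (?P 0) G"
    by (auto simp: mon_def hom_def inj_on_def)
  then have "\<exists>n. (\<exists>\<phi>. \<phi> \<in> mon (?P n) G) \<and> (\<forall>m. (\<exists>\<phi>. \<phi> \<in> mon (?P m) G) \<longrightarrow> m \<le> n)"
    using bound by (intro Nat.ex_has_greatest_nat[of _ 0 "card (carrier G)"]) blast+
  then obtain n \<phi> where \<phi>: "\<phi> \<in> mon (?P n) G" and max: "\<And>m \<phi>. \<phi> \<in> mon (?P m) G \<Longrightarrow> m \<le> n"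
    by blast
  have "carrier G \<subseteq> \<phi> ` carrier (?P n)"
  proof
    fix a assume "a \<in> carrier G"
    then show "a \<in> \<phi> ` carrier (?P n)"
      using max[OF mon_product_Z2_extend[OF inv2 \<phi>]] by force
  qed
  then have "\<phi> \<in> iso (?P n) G"
    using \<phi> by (auto simp: mon_def iso_def bij_betw_def hom_def)
  then show ?thesis
    using group.iso_sym[OF grp] is_isoI by blast
qed

text \<open>In the product every element doubles to the identity, since each coordinate does so
  modulo 2; the injective \<open>h\<close> carries this back to \<open>G\<close>.\<close>

lemma iso_product_Z2_imp_involution:
  assumes "G \<cong> product_group I (\<lambda>_. integer_mod_group 2)" and x: "x \<in> carrier G"
  shows "x \<otimes> x = \<one>"
proof -
  let ?P = "product_group I (\<lambda>_. integer_mod_group 2)"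
  obtain h where h: "h \<in> iso G ?P" using assms(1) by (auto simp: is_iso_def)
  then have hom: "h \<in> hom G ?P" and inj: "inj_on h (carrier G)"
    by (auto simp: iso_def bij_betw_def)
  have "h (x \<otimes> x) = h x \<otimes>\<^bsub>?P\<^esub> h x" using hom x by (simp add: hom_mult del: mult_product_group)
  also have "\<dots> = \<one>\<^bsub>?P\<^esub>" by (auto simp flip: mult_2)
  also have "\<dots> = h \<one>" using hom_one[OF hom group_axioms] by simp
  finally show ?thesis using inj x by (auto dest: inj_onD)
qed

end

theorem theorem2p6:
  fixes G :: "'a monoid"
  assumes "group G" and "finite (carrier G)"
  shows "minimally_connected (enhanced_power_graph G) \<longleftrightarrow>
    cyclic_group G \<or>
    (\<exists>n::nat. G \<cong> product_group {..<n} (\<lambda>_. integer_mod_group 2))"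
proof -
  interpret group G by fact
  have "minimally_connected (enhanced_power_graph G)" if "cyclic_group G"
    using that assms(2) cyclic_iff_enhanced_power_graph_complete[OF assms(2)]
    by (intro minimally_connected_complete sym_parcs_enhanced_power_graph)
      (auto simp: parcs_enhanced_power_graph irrefl_def)
  \<comment> \<open>In the noncyclic case both directions pass through the identity
    \<open>x \<otimes> x = \<one>\<close>.\<close>
  then show ?thesis
    using minimally_connected_imp_involutions[OF assms(2)]
      involutions_imp_iso_product_Z2[OF assms(2)]
      involutions_imp_minimally_connected[OF assms(2)] iso_product_Z2_imp_involution
    by blast
qed

end
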